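(* Let $a,b,c,d$ be positive integers such that (i) $a>1$, $d>c$, $b$ is even, and $d\equiv c \pmod 2$; (ii) $a(d-c) > b\,|d-a|$; (iii) $a<c$ and $d\geq b+c$; (iv) either $a<b$, or both $a\geq b$ and $d(a-b)<ac$. Let $V=\{(x,y,z)\in\mathbb{R}^3 : y^a=z^bx^c+x^d\}$, regarded as a germ at the origin, and let $Oz=\{(0,0,z): z\in\mathbb{R}\}$ be the $z$-axis. Then the pair $(V\setminus Oz,\,Oz)$ is Whitney $(b)$-regular at the origin but is not Kuo-Verdier $(w)$-regular at the origin. In particular, there are infinitely many quadruples $(a,b,c,d)$ of positive integers for which the pair $(V\setminus Oz,\,Oz)$ defined by the real algebraic surface $V=\{y^a=z^bx^c+x^d\}$ is $(b)$-regular at the origin and not $(w)$-regular at the origin.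
   Context: Let $X,Y$ be disjoint smooth submanifolds of $\mathbb{R}^n$ and let $y_0\in Y\cap\overline{X}$. The pair $(X,Y)$ is $(b)$-regular at $y_0$ if for all sequences $\{x_i\}$ in $X$ and $\{y_i\}$ in $Y$ converging to $y_0$ such that the tangent spaces $T_{x_i}X$ converge to a linear subspace $\alpha$ and the unit vectors in the directions $\overline{x_iy_i}$ converge to $\lambda$, one has $\lambda\in\alpha$. The pair $(X,Y)$ is $(w)$-regular at $y_0$ if there are a constant $C>0$ and a neighbourhood $U$ of $y_0$ such that $\delta(T_yY,T_xX)\leq C|x-y|$ for all $y\in U\cap Y$ and all $x\in U\cap X$. Here, for linear subspaces $A,B\subset\mathbb{R}^n$, $\delta(A,B)=\sup\{\operatorname{dist}(v,B): v\in A,\ |v|=1\}$. *)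

theory Defs
  imports "HOL-Analysis.Analysis" "HOL-Number_Theory.Cong"
begin

section \<open>Smooth submanifolds and tangent spaces\<close>

text \<open>The functions of class \<open>C\<^sup>k\<close> on an open set \<open>S\<close>: all iterated directional derivatives up
  to order \<open>k\<close> exist as total derivatives and are continuous. For open \<open>S\<close> only the values of
  \<open>f\<close> on \<open>S\<close> matter.\<close>

primrec Ck_on :: "nat \<Rightarrow> ('a::euclidean_space \<Rightarrow> 'b::euclidean_space) \<Rightarrow> 'a set \<Rightarrow> bool" where
  "Ck_on 0 f S \<longleftrightarrow> continuous_on S f"
| "Ck_on (Suc k) f S \<longleftrightarrow>
     (\<forall>x\<in>S. f differentiable (at x)) \<and>
     (\<forall>v. Ck_on k (\<lambda>x. frechet_derivative f (at x) v) S)"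

definition smooth_on :: "('a::euclidean_space \<Rightarrow> 'b::euclidean_space) \<Rightarrow> 'a set \<Rightarrow> bool" where
  "smooth_on f S \<longleftrightarrow> (\<forall>k. Ck_on k f S)"

text \<open>An embedded submanifold (not necessarily closed): near each of its points the ambient space
  can be straightened by a smooth diffeomorphism carrying \<open>M\<close> to a \<open>k\<close>-dimensional linear
  subspace.\<close>

definition smooth_submanifold_dim :: "nat \<Rightarrow> 'a::euclidean_space set \<Rightarrow> bool" where
  "smooth_submanifold_dim k M \<longleftrightarrow>
     (\<forall>p\<in>M. \<exists>U W \<phi> \<psi> L.
        open U \<and> p \<in> U \<and> open (W :: 'a set) \<and>
        homeomorphism U W \<phi> \<psi> \<and> smooth_on \<phi> U \<and> smooth_on \<psi> W \<and>
        subspace L \<and> dim L = k \<and> \<phi> ` (U \<inter> M) = W \<inter> L)"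

definition smooth_submanifold :: "'a::euclidean_space set \<Rightarrow> bool" where
  "smooth_submanifold M \<longleftrightarrow> (\<exists>k. smooth_submanifold_dim k M)"

text \<open>Velocity vectors at \<open>p\<close> of curves in \<open>M\<close>. For a smooth submanifold it makes no difference
  whether the curves are required to be smooth or, as here, only differentiable at time \<open>0\<close>.\<close>

definition tangent_space :: "'a::euclidean_space set \<Rightarrow> 'a \<Rightarrow> 'a set" where
  "tangent_space M p =
     {v. \<exists>\<gamma>::real \<Rightarrow> 'a. (\<forall>t. \<gamma> t \<in> M) \<and> \<gamma> 0 = p \<and> (\<gamma> has_vector_derivative v) (at 0)}"

section \<open>Linear subspaces\<close>

text \<open>The case distinction fixes the supremum over the empty set, for \<open>A = {0}\<close>, to be \<open>0\<close>.\<close>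

definition subspace_delta :: "'a::euclidean_space set \<Rightarrow> 'a set \<Rightarrow> real" where
  "subspace_delta A B =
     (if A \<subseteq> {0} then 0 else Sup {infdist v B | v. v \<in> A \<and> norm v = 1})"

text \<open>Convergence in the Grassmannian, expressed with the gap metric
  \<open>max (\<delta> A B) (\<delta> B A)\<close>, which is the operator norm of the difference of the orthogonal projections
  onto \<open>A\<close> and \<open>B\<close>. Subspaces of different dimensions have gap \<open>1\<close>.\<close>

definition subspaces_converge :: "(nat \<Rightarrow> 'a::euclidean_space set) \<Rightarrow> 'a set \<Rightarrow> bool" where
  "subspaces_converge T \<alpha> \<longleftrightarrow>
     subspace \<alpha> \<and>
     (\<lambda>i. max (subspace_delta (T i) \<alpha>) (subspace_delta \<alpha> (T i))) \<longlonglongrightarrow> 0"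

section \<open>Regularity conditions\<close>

definition incident_submanifolds :: "'a::euclidean_space set \<Rightarrow> 'a set \<Rightarrow> 'a \<Rightarrow> bool" where
  "incident_submanifolds X Y y0 \<longleftrightarrow>
     smooth_submanifold X \<and> smooth_submanifold Y \<and> X \<inter> Y = {} \<and> y0 \<in> Y \<inter> closure X"

text \<open>In a real normed space \<open>sgn v\<close> is the unit vector \<open>v /\<^sub>R norm v\<close>.\<close>

definition b_regular :: "'a::euclidean_space set \<Rightarrow> 'a set \<Rightarrow> 'a \<Rightarrow> bool" where
  "b_regular X Y y0 \<longleftrightarrow>
     (\<forall>x y \<alpha> l.
        (\<forall>i::nat. x i \<in> X) \<and> (\<forall>i. y i \<in> Y) \<and> x \<longlonglongrightarrow> y0 \<and> y \<longlonglongrightarrow> y0 \<and>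
        subspaces_converge (\<lambda>i. tangent_space X (x i)) \<alpha> \<and>
        (\<lambda>i. sgn (y i - x i)) \<longlonglongrightarrow> l
        \<longrightarrow> l \<in> \<alpha>)"

definition w_regular :: "'a::euclidean_space set \<Rightarrow> 'a set \<Rightarrow> 'a \<Rightarrow> bool" where
  "w_regular X Y y0 \<longleftrightarrow>
     (\<exists>C>0. \<exists>U. open U \<and> y0 \<in> U \<and>
        (\<forall>y\<in>U \<inter> Y. \<forall>x\<in>U \<inter> X.
           subspace_delta (tangent_space Y y) (tangent_space X x) \<le> C * norm (x - y)))"

section \<open>The surfaces\<close>

definition surface :: "nat \<Rightarrow> nat \<Rightarrow> nat \<Rightarrow> nat \<Rightarrow> (real^3) set" where
  "surface a b c d = {p. (p$2) ^ a = (p$3) ^ b * (p$1) ^ c + (p$1) ^ d}"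

definition z_axis :: "(real^3) set" where
  "z_axis = {vector [0, 0, z] | z. True}"

end

theory Submission
  imports Defs
begin

text \<open>Off the axis \<open>x\<close> and \<open>y\<close> do not vanish, \<open>\<bar>y\<bar>\<^sup>a = \<bar>z\<bar>\<^sup>b \<bar>x\<bar>\<^sup>c + \<bar>x\<bar>\<^sup>d\<close>, and the surface is locally a
  smooth graph over the \<open>xz\<close>-plane, so its tangent plane is the orthogonal complement of the
  gradient of \<open>F = y\<^sup>a - z\<^sup>b x\<^sup>c - x\<^sup>d\<close>.

  (b): a secant from \<open>(x, y, z)\<close> to the axis splits into the radial part \<open>(x, y, 0)\<close> and a vertical
  part. As \<open>\<bar>x F\<^sub>x + y F\<^sub>y\<bar> \<le> d \<bar>y\<bar>\<^sup>a\<close> and \<open>\<bar>y F\<^sub>y\<bar> = a \<bar>y\<bar>\<^sup>a\<close>, the radial part contributes at most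
  \<open>d \<bar>y\<bar> / \<bar>x\<bar>\<close>, which tends to \<open>0\<close> because \<open>a < c < d\<close>. The vertical part contributes
  \<open>\<bar>F\<^sub>z\<bar> / \<bar>F\<^sub>y\<bar>\<close>, whose \<open>bd\<close>-th power is bounded by a multiple of \<open>\<bar>y\<bar>\<close> to the power
  \<open>bd - a(d - c)\<close>; condition (iv) says that this exponent is positive.

  Not (w): on the curve \<open>x = s\<close> to the \<open>ab\<close>, \<open>z = s\<close> to the \<open>a(d - c)\<close>, the quotient of the distance
  from the axis direction to the tangent plane by the distance to the axis grows like \<open>s\<close> to the
  power \<open>b(d - a) - a(d - c)\<close>, which is negative by (ii).\<close>

section \<open>Smooth functions\<close>

text \<open>A derivative at a point depends only on values nearby, so on an open set agreement of
  the functions passes to all iterated derivatives.\<close>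

lemma Ck_on_cong:
  assumes "open S" "\<And>x. x \<in> S \<Longrightarrow> f x = g x" "Ck_on k f S"
  shows "Ck_on k g S"
  using assms(2,3)
proof (induction k arbitrary: f g)
  case 0
  then show ?case using continuous_on_cong by (metis Ck_on.simps(1))
next
  case (Suc k)
  have D: "(g has_derivative frechet_derivative f (at x)) (at x)" if "x \<in> S" for x
    using Suc.prems that assms(1)
    by (metis Ck_on.simps(2) frechet_derivative_works has_derivative_transform_within_open)
  then have "frechet_derivative f (at x) = frechet_derivative g (at x)" if "x \<in> S" for x
    using that frechet_derivative_at by blast
  with Suc have "Ck_on k (\<lambda>x. frechet_derivative g (at x) v) S" for v
    by (metis (no_types, lifting) Ck_on.simps(2))
  with D show ?case by (auto simp: differentiable_def)
qed

text \<open>Admits an explicit derivative \<open>f'\<close> in place of the chosen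
  \<open>frechet_derivative\<close>; the calculus rules below rest on it.\<close>

lemma Ck_on_SucI:
  assumes "open S" "\<And>x. x \<in> S \<Longrightarrow> (f has_derivative f' x) (at x)"
    and "\<And>v. Ck_on k (\<lambda>x. f' x v) S"
  shows "Ck_on (Suc k) f S"
proof -
  have "Ck_on k (\<lambda>x. frechet_derivative f (at x) v) S" for v
    by (rule Ck_on_cong[OF assms(1) _ assms(3)[of v]])
      (metis assms(2) frechet_derivative_at)
  with assms(2) show ?thesis by (auto simp: differentiable_def)
qed

lemma Ck_on_Suc_derivative:
  assumes "Ck_on (Suc k) f S" "x \<in> S"
  shows "(f has_derivative frechet_derivative f (at x)) (at x)"
  using assms frechet_derivative_works by auto

lemma Ck_on_lower: "Ck_on (Suc k) f S \<Longrightarrow> Ck_on k f S"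
proof (induction k arbitrary: f)
  case 0
  then show ?case
    by (auto intro!: continuous_at_imp_continuous_on differentiable_imp_continuous_within)
next
  case (Suc k)
  then show ?case by (metis Ck_on.simps(2))
qed

lemma Ck_on_const: "open S \<Longrightarrow> Ck_on k (\<lambda>_. c) S"
proof (induction k arbitrary: c)
  case (Suc k)
  show ?case
    by (rule Ck_on_SucI[where f' = "\<lambda>_ _. 0"]) (use Suc in auto)
qed simp

lemma Ck_on_bounded_linear:
  assumes "bounded_linear f" "open S"
  shows "Ck_on k f S"
proof (cases k)
  case 0
  then show ?thesis using assms by (simp add: linear_continuous_on)
next
  case (Suc m)
  show ?thesis unfolding Suc
    by (rule Ck_on_SucI[where f' = "\<lambda>_. f"])
      (use assms in \<open>auto intro: bounded_linear_imp_has_derivative Ck_on_const\<close>)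
qed

lemma Ck_on_add:
  assumes "open S" "Ck_on k f S" "Ck_on k g S"
  shows "Ck_on k (\<lambda>x. f x + g x) S"
  using assms(2,3)
proof (induction k arbitrary: f g)
  case 0
  then show ?case by (auto intro: continuous_intros)
next
  case (Suc k)
  show ?case
    by (rule Ck_on_SucI[where
          f' = "\<lambda>x v. frechet_derivative f (at x) v + frechet_derivative g (at x) v"])
      (use Suc assms(1) in \<open>auto intro!: has_derivative_add Ck_on_Suc_derivative\<close>)
qed

text \<open>The product rule leaves one factor undifferentiated in each summand, so the induction
  step also needs \<open>f\<close> and \<open>g\<close> at order \<open>k\<close>;
  \<open>Ck_on_lower\<close> supplies this.\<close>

lemma Ck_on_scaleR:
  fixes f :: "'a::euclidean_space \<Rightarrow> real" and g :: "'a \<Rightarrow> 'b::euclidean_space"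
  assumes "open S" "Ck_on k f S" "Ck_on k g S"
  shows "Ck_on k (\<lambda>x. f x *\<^sub>R g x) S"
  using assms(2,3)
proof (induction k arbitrary: f g)
  case 0
  then show ?case by (auto intro: continuous_intros)
next
  case (Suc k)
  show ?case
  proof (rule Ck_on_SucI[where f' = "\<lambda>x v. f x *\<^sub>R frechet_derivative g (at x) v
            + frechet_derivative f (at x) v *\<^sub>R g x"])
    show "Ck_on k (\<lambda>x. f x *\<^sub>R frechet_derivative g (at x) v
            + frechet_derivative f (at x) v *\<^sub>R g x) S" for v
      using Suc assms(1) Ck_on_lower[OF Suc.prems(1)] Ck_on_lower[OF Suc.prems(2)]
      by (intro Ck_on_add) auto
  qed (use Suc.prems assms(1) in \<open>auto intro!: has_derivative_scaleR Ck_on_Suc_derivative\<close>)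
qed

lemma Ck_on_mult:
  fixes f g :: "'a::euclidean_space \<Rightarrow> real"
  assumes "open S" "Ck_on k f S" "Ck_on k g S"
  shows "Ck_on k (\<lambda>x. f x * g x) S"
  using Ck_on_scaleR[OF assms] by simp

lemma Ck_on_power:
  fixes f :: "'a::euclidean_space \<Rightarrow> real"
  assumes "open S" "Ck_on k f S"
  shows "Ck_on k (\<lambda>x. f x ^ n) S"
  by (induction n) (use assms in \<open>auto intro: Ck_on_const Ck_on_mult\<close>)

text \<open>Differentiation lowers the exponent by one, so the induction treats all real
  \<open>r\<close> at once.\<close>

lemma Ck_on_powr:
  fixes f :: "'a::euclidean_space \<Rightarrow> real"
  assumes "open S" "\<And>x. x \<in> S \<Longrightarrow> f x > 0" "Ck_on k f S"
  shows "Ck_on k (\<lambda>x. f x powr r) S"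
  using assms(3)
proof (induction k arbitrary: r)
  case 0
  then show ?case using assms(2) by (force intro!: continuous_intros)
next
  case (Suc k)
  show ?case
  proof (rule Ck_on_SucI[where
        f' = "\<lambda>x v. r * f x powr (r - 1) * frechet_derivative f (at x) v"])
    show "((\<lambda>x. f x powr r) has_derivative
        (\<lambda>v. r * f x powr (r - 1) * frechet_derivative f (at x) v)) (at x)" if "x \<in> S" for x
      using has_derivative_compose[OF Ck_on_Suc_derivative[OF Suc.prems that]
          has_real_derivative_powr[OF assms(2)[OF that], unfolded has_field_derivative_def]]
      by simp
    show "Ck_on k (\<lambda>x. r * f x powr (r - 1) * frechet_derivative f (at x) v) S" for v
      using Suc Ck_on_lower[OF Suc.prems] assms(1)
      by (intro Ck_on_mult Ck_on_const) auto
  qed fact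
qed

section \<open>Linear subspaces\<close>

lemma infdist_subspace_scaleR_le:
  fixes B :: "'a::euclidean_space set"
  assumes "subspace B"
  shows "infdist (r *\<^sub>R v) B \<le> \<bar>r\<bar> * infdist v B"
proof -
  obtain w where w: "w \<in> B" "infdist v B = dist v w"
    using infdist_attains_inf[OF closed_subspace[OF assms], of v] subspace_0[OF assms] by blast
  have "infdist (r *\<^sub>R v) B \<le> dist (r *\<^sub>R v) (r *\<^sub>R w)"
    using w(1) assms by (intro infdist_le) (simp add: subspace_scale)
  then show ?thesis
    by (simp add: w(2) dist_norm flip: scaleR_diff_right)
qed

text \<open>The distance to 0 gives the bound 1. Boundedness makes the \<open>Sup\<close> in
  \<open>subspace_delta\<close> a genuine supremum.\<close>

lemma bdd_above_infdist_unit: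
  assumes "0 \<in> B"
  shows "bdd_above {infdist v B | v. v \<in> A \<and> norm v = 1}"
  using infdist_le[OF assms] by (intro bdd_aboveI[where M = 1]) (auto, metis)

lemma infdist_le_subspace_delta:
  fixes A B :: "'a::euclidean_space set"
  assumes "0 \<in> B" "v \<in> A" "norm v = 1"
  shows "infdist v B \<le> subspace_delta A B"
proof -
  have "\<not> A \<subseteq> {0}" using assms by auto
  moreover have "infdist v B \<le> Sup {infdist v B | v. v \<in> A \<and> norm v = 1}"
    using assms by (intro cSup_upper bdd_above_infdist_unit) auto
  ultimately show ?thesis by (simp add: subspace_delta_def)
qed

lemma infdist_le_norm_subspace_delta:
  fixes A B :: "'a::euclidean_space set"
  assumes "subspace A" "subspace B" "v \<in> A"
  shows "infdist v B \<le> norm v * subspace_delta A B"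
proof (cases "v = 0")
  case True
  then show ?thesis using subspace_0[OF assms(2)] by simp
next
  case False
  have "infdist v B = infdist (norm v *\<^sub>R sgn v) B"
    using False by (simp add: sgn_div_norm)
  also have "\<dots> \<le> norm v * infdist (sgn v) B"
    using infdist_subspace_scaleR_le[OF assms(2), of "norm v" "sgn v"] by simp
  also have "\<dots> \<le> norm v * subspace_delta A B"
    using assms False
    by (intro mult_left_mono infdist_le_subspace_delta)
      (auto simp: subspace_0 norm_sgn sgn_div_norm subspace_scale)
  finally show ?thesis .
qed

text \<open>Cauchy-Schwarz for \<open>n\<close> and \<open>v - w\<close>, where \<open>w\<close> is
  the point of the hyperplane nearest to \<open>v\<close>.\<close>

lemma infdist_hyperplane_ge:
  fixes n :: "'a::euclidean_space"
  assumes "n \<noteq> 0"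
  shows "\<bar>n \<bullet> v\<bar> / norm n \<le> infdist v {w. n \<bullet> w = 0}"
proof -
  have "0 \<in> {w. n \<bullet> w = 0}" by simp
  then obtain w where w: "n \<bullet> w = 0" "infdist v {w. n \<bullet> w = 0} = dist v w"
    using infdist_attains_inf[OF closed_hyperplane, of n 0 v] by blast
  have "\<bar>n \<bullet> v\<bar> = \<bar>n \<bullet> (v - w)\<bar>" using w by (simp add: inner_diff_right)
  also have "\<dots> \<le> norm n * dist v w" by (metis Cauchy_Schwarz_ineq2 dist_norm)
  finally show ?thesis using assms w by (simp add: field_simps)
qed

text \<open>Reduces (b) to a scalar limit: if the normal components of the secants tend to 0, their
  projections to the hyperplanes have the same limit \<open>l\<close>, and the gap forces that limit
  into the closed set \<alpha>.\<close>

lemma limit_of_hyperplanes: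
  fixes n s :: "nat \<Rightarrow> 'a::euclidean_space"
  assumes conv: "subspaces_converge (\<lambda>i. {v. n i \<bullet> v = 0}) \<alpha>"
    and s: "s \<longlonglongrightarrow> l"
    and small: "(\<lambda>i. (n i \<bullet> s i) / norm (n i)) \<longlonglongrightarrow> 0"
    and n0: "\<And>i. n i \<noteq> 0"
  shows "l \<in> \<alpha>"
proof -
  \<comment> \<open>\<open>t i\<close> is the orthogonal projection of \<open>s i\<close> onto the
    hyperplane normal to \<open>n i\<close>.\<close>
  define t where "t i = s i - ((n i \<bullet> s i) / norm (n i)) *\<^sub>R sgn (n i)" for i
  have "(\<lambda>i. norm (((n i \<bullet> s i) / norm (n i)) *\<^sub>R sgn (n i))) \<longlonglongrightarrow> 0"
    using tendsto_norm_zero[OF small] n0 by (simp add: norm_sgn)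
  then have "(\<lambda>i. ((n i \<bullet> s i) / norm (n i)) *\<^sub>R sgn (n i)) \<longlonglongrightarrow> 0"
    by (rule tendsto_norm_zero_cancel)
  then have t: "t \<longlonglongrightarrow> l"
    using tendsto_diff[OF s] unfolding t_def by fastforce
  have t_in: "t i \<in> {v. n i \<bullet> v = 0}" for i
    using n0[of i] by (simp add: t_def inner_diff_right sgn_div_norm dot_square_norm power2_eq_square)
  let ?m = "\<lambda>i. max (subspace_delta {v. n i \<bullet> v = 0} \<alpha>) (subspace_delta \<alpha> {v. n i \<bullet> v = 0})"
  have \<alpha>: "subspace \<alpha>" and m: "?m \<longlonglongrightarrow> 0" using conv by (auto simp: subspaces_converge_def)
  have le: "infdist (t i) \<alpha> \<le> norm (t i) * ?m i" for i
  proof -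
    have "infdist (t i) \<alpha> \<le> norm (t i) * subspace_delta {v. n i \<bullet> v = 0} \<alpha>"
      by (rule infdist_le_norm_subspace_delta[OF subspace_hyperplane \<alpha> t_in])
    also have "\<dots> \<le> norm (t i) * ?m i" by (intro mult_left_mono) auto
    finally show ?thesis .
  qed
  have lim: "(\<lambda>i. norm (t i) * ?m i) \<longlonglongrightarrow> 0"
    using tendsto_mult[OF tendsto_norm[OF t] m] by simp
  have "(\<lambda>i. infdist (t i) \<alpha>) \<longlonglongrightarrow> 0"
    by (rule Lim_null_comparison[OF _ lim]) (use le in \<open>simp add: infdist_nonneg\<close>)
  moreover have "(\<lambda>i. infdist (t i) \<alpha>) \<longlonglongrightarrow> infdist l \<alpha>"
    using t by (rule tendsto_infdist)
  ultimately have "infdist l \<alpha> = 0" using LIMSEQ_unique by blast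
  then show ?thesis
    using in_closed_iff_infdist_zero[OF closed_subspace[OF \<alpha>]] subspace_0[OF \<alpha>] by blast
qed

section \<open>The z-axis\<close>

lemma z_axis_iff: "p \<in> z_axis \<longleftrightarrow> p $ 1 = 0 \<and> p $ 2 = 0"
  unfolding z_axis_def by (auto simp: vec_eq_iff forall_3)

lemma subspace_z_axis: "subspace z_axis"
  by (auto simp: subspace_def z_axis_iff)

lemma smooth_submanifold_subspace:
  fixes L :: "'a::euclidean_space set"
  assumes "subspace L"
  shows "smooth_submanifold L"
proof -
  have "smooth_on (\<lambda>x::'a. x) UNIV"
    by (auto simp: smooth_on_def intro: Ck_on_bounded_linear bounded_linear_ident)
  then have "smooth_submanifold_dim (dim L) L"
    unfolding smooth_submanifold_dim_def using assms
    by (intro ballI exI[where x = UNIV] exI[where x = "\<lambda>x. x"] exI[where x = L])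
      (auto simp: homeomorphism_def)
  then show ?thesis by (auto simp: smooth_submanifold_def)
qed

lemma axis_in_tangent_z_axis:
  assumes "p \<in> z_axis"
  shows "axis 3 1 \<in> tangent_space z_axis p"
proof -
  have "((\<lambda>t::real. p + t *\<^sub>R axis 3 1) has_vector_derivative axis 3 1) (at 0)"
    by (auto intro!: derivative_eq_intros simp: has_vector_derivative_def)
  then show ?thesis using assms unfolding tangent_space_def z_axis_iff
    by (auto intro!: exI[where x = "\<lambda>t. p + t *\<^sub>R axis 3 1"] simp: axis_def)
qed


section \<open>The surface off the z-axis\<close>

lemma power_tendsto_zero_cancel:
  fixes f :: "'a \<Rightarrow> real"
  assumes "k > 0" "\<And>i. f i \<ge> 0" "((\<lambda>i. f i ^ k) \<longlongrightarrow> 0) F"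
  shows "(f \<longlongrightarrow> 0) F"
  using tendsto_real_root[OF assms(3), of k] assms(1,2)
  by (simp add: real_root_power_cancel)

text \<open>The conditions in the form used below. \<open>not_w_exponent\<close> is (ii), where the
  absolute value is d - a because a < c < d; \<open>b_exponent\<close> follows from either
  alternative of (iv). All natural subtractions here are genuine.\<close>

locale surface_parameters =
  fixes a b c d :: nat
  assumes a_gt: "1 < a" and a_less: "a < c" and c_less: "c < d"
    and b_even: "even b" and b_pos: "0 < b" and dc_even: "even (d - c)"
    and not_w_exponent: "b * (d - a) < a * (d - c)"
    and b_exponent: "a * (d - c) < b * d"
begin

abbreviation X :: "(real^3) set" where
  "X \<equiv> surface a b c d - z_axis"

section \<open>The equation of the surface and its gradient\<close>

definition Q :: "real^3 \<Rightarrow> real" where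
  "Q p = (p $ 3) ^ b * (p $ 1) ^ c + (p $ 1) ^ d"

definition grad :: "real^3 \<Rightarrow> real^3" where
  "grad p = vector [- (c * (p $ 3) ^ b * (p $ 1) ^ (c - 1) + d * (p $ 1) ^ (d - 1)),
     a * (p $ 2) ^ (a - 1), - (b * (p $ 3) ^ (b - 1) * (p $ 1) ^ c)]"

lemma grad_nth [simp]:
  "grad p $ 1 = - (c * (p $ 3) ^ b * (p $ 1) ^ (c - 1) + d * (p $ 1) ^ (d - 1))"
  "grad p $ 2 = a * (p $ 2) ^ (a - 1)"
  "grad p $ 3 = - (b * (p $ 3) ^ (b - 1) * (p $ 1) ^ c)"
  by (simp_all add: grad_def)

lemma inner_grad:
  "grad p \<bullet> v = grad p $ 1 * v $ 1 + grad p $ 2 * v $ 2 + grad p $ 3 * v $ 3"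
  by (simp add: inner_vec_def sum_3)

(* z^b x^c and x^d have the same sign, b and d - c being even. *)
lemma abs_Q: "\<bar>Q p\<bar> = \<bar>p $ 3\<bar> ^ b * \<bar>p $ 1\<bar> ^ c + \<bar>p $ 1\<bar> ^ d"
proof -
  obtain e where d: "d = c + e" and e: "even e"
    using c_less dc_even by (metis add_diff_cancel_left' less_imp_add_positive)
  have "Q p = (p $ 1) ^ c * ((p $ 3) ^ b + (p $ 1) ^ e)"
    unfolding Q_def by (simp add: d power_add algebra_simps)
  also have "\<bar>\<dots>\<bar> = \<bar>p $ 1\<bar> ^ c * (\<bar>p $ 3\<bar> ^ b + \<bar>p $ 1\<bar> ^ e)"
    using b_even e by (simp add: abs_mult power_abs power_even_abs abs_of_nonneg zero_le_even_power)
  also have "\<dots> = \<bar>p $ 3\<bar> ^ b * \<bar>p $ 1\<bar> ^ c + \<bar>p $ 1\<bar> ^ d"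
    by (simp add: d power_add algebra_simps)
  finally show ?thesis .
qed

lemma Q_eq_0_iff: "Q p = 0 \<longleftrightarrow> p $ 1 = 0"
proof -
  have "Q p \<noteq> 0" if "p $ 1 \<noteq> 0"
    using abs_Q[of p] that by (smt (verit) mult_nonneg_nonneg zero_less_power zero_le_power)
  moreover have "Q p = 0" if "p $ 1 = 0" using that a_less c_less by (simp add: Q_def power_0_left)
  ultimately show ?thesis by blast
qed

text \<open>Where x = 0 the equation forces y = 0, so on the surface, removing the axis amounts to
  removing the plane x = 0.\<close>

lemma X_iff: "p \<in> X \<longleftrightarrow> (p $ 2) ^ a = Q p \<and> p $ 1 \<noteq> 0"
  using Q_eq_0_iff[of p] a_gt by (auto simp: surface_def z_axis_iff Q_def)

lemma X_nonzero:
  assumes "p \<in> X"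
  shows "p $ 1 \<noteq> 0" "p $ 2 \<noteq> 0"
  using assms[unfolded X_iff] Q_eq_0_iff[of p] a_gt by (auto simp: power_0_left)

lemma X_abs:
  assumes "p \<in> X"
  shows "\<bar>p $ 2\<bar> ^ a = \<bar>p $ 3\<bar> ^ b * \<bar>p $ 1\<bar> ^ c + \<bar>p $ 1\<bar> ^ d"
  using assms[unfolded X_iff] abs_Q[of p] by (metis power_abs)

lemma grad_nonzero:
  assumes "p \<in> X"
  shows "grad p \<noteq> 0"
proof -
  have "grad p $ 2 \<noteq> 0" using X_nonzero[OF assms] a_gt by simp
  then show ?thesis by (metis zero_index)
qed

lemma has_derivative_equation:
  "((\<lambda>p. (p $ 2) ^ a - Q p) has_derivative (\<lambda>v. grad p \<bullet> v)) (at p)"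
proof -
  have [derivative_intros]: "((\<lambda>p :: real^3. p $ i) has_derivative (\<lambda>v. v $ i)) (at p)" for i
    by (intro bounded_linear_imp_has_derivative bounded_linear_vec_nth)
  show ?thesis
    unfolding Q_def inner_grad
    by (auto intro!: derivative_eq_intros simp: algebra_simps)
qed

section \<open>The sheets of the surface as graphs over the xz-plane\<close>

text \<open>For \<sigma> = 1 or -1 this is the root y of \<open>y ^ a = Q p\<close> of sign
  \<sigma>: the equation reads \<open>(\<sigma> * y) ^ a = \<sigma> ^ a * Q p\<close>, with positive
  right side on \<open>graph_domain \<sigma>\<close>. Only x and z matter, but the argument is a
  point of space, which suits the shears used as charts.\<close>

definition graph :: "real \<Rightarrow> real^3 \<Rightarrow> real" where
  "graph \<sigma> p = \<sigma> * (\<sigma> ^ a * Q p) powr (1 / a)"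

definition graph_domain :: "real \<Rightarrow> (real^3) set" where
  "graph_domain \<sigma> = {p. 0 < \<sigma> ^ a * Q p}"

lemma Q_shift: "Q (p + r *\<^sub>R axis 2 1) = Q p"
  by (simp add: Q_def axis_def)

lemma graph_shift: "graph \<sigma> (p + r *\<^sub>R axis 2 1) = graph \<sigma> p"
  by (simp add: graph_def Q_shift)

lemma graph_domain_shift: "p + r *\<^sub>R axis 2 1 \<in> graph_domain \<sigma> \<longleftrightarrow> p \<in> graph_domain \<sigma>"
  by (simp add: graph_domain_def Q_shift)

lemma continuous_on_Q: "continuous_on S Q"
  unfolding Q_def by (intro continuous_intros)

lemma open_graph_domain: "open (graph_domain \<sigma>)"
  unfolding graph_domain_def by (intro open_Collect_less continuous_intros continuous_on_Q)

lemma Ck_on_Q: "open S \<Longrightarrow> Ck_on k Q S"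
  unfolding Q_def
  by (intro Ck_on_add Ck_on_mult Ck_on_power Ck_on_bounded_linear bounded_linear_vec_nth)

lemma Ck_on_graph: "Ck_on k (graph \<sigma>) (graph_domain \<sigma>)"
  unfolding graph_def
  by (intro Ck_on_mult Ck_on_const Ck_on_powr open_graph_domain Ck_on_Q)
    (auto simp: graph_domain_def)

lemma graph_power:
  assumes "\<bar>\<sigma>\<bar> = 1" "p \<in> graph_domain \<sigma>"
  shows "graph \<sigma> p ^ a = Q p" "0 < \<sigma> * graph \<sigma> p"
proof -
  have \<sigma>: "\<sigma> * \<sigma> = 1" using assms(1) by (metis abs_mult_self mult_1)
  have pos: "0 < \<sigma> ^ a * Q p" using assms(2) by (simp add: graph_domain_def)
  have "((\<sigma> ^ a * Q p) powr (1 / a)) ^ a = \<sigma> ^ a * Q p"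
    using pos a_gt by (subst powr_power) (auto simp: power_0_left)
  then have "graph \<sigma> p ^ a = (\<sigma> * \<sigma>) ^ a * Q p"
    by (simp add: graph_def power_mult_distrib)
  then show "graph \<sigma> p ^ a = Q p" by (simp add: \<sigma>)
  show "0 < \<sigma> * graph \<sigma> p"
    using pos \<sigma> by (auto simp: graph_def mult.assoc[symmetric])
qed

lemma X_iff_graph:
  assumes "\<bar>\<sigma>\<bar> = 1" "0 < \<sigma> * p $ 2"
  shows "p \<in> X \<longleftrightarrow> p \<in> graph_domain \<sigma> \<and> p $ 2 = graph \<sigma> p"
proof
  have \<sigma>: "\<sigma> * \<sigma> = 1" using assms(1) by (metis abs_mult_self mult_1)
  assume "p \<in> X"
  then have eq: "\<sigma> ^ a * Q p = (\<sigma> * p $ 2) ^ a" unfolding X_iff by (simp add: power_mult_distrib)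
  have "((\<sigma> * p $ 2) ^ a) powr (1 / a) = \<sigma> * p $ 2"
    using assms(2) a_gt by (simp add: powr_realpow[symmetric] powr_powr)
  then have "graph \<sigma> p = \<sigma> * \<sigma> * p $ 2"
    by (simp add: graph_def eq)
  then show "p \<in> graph_domain \<sigma> \<and> p $ 2 = graph \<sigma> p"
    using assms(2) by (simp add: \<sigma> eq graph_domain_def)
next
  assume p: "p \<in> graph_domain \<sigma> \<and> p $ 2 = graph \<sigma> p"
  then have "(p $ 2) ^ a = Q p" using graph_power assms(1) by simp
  moreover have "Q p \<noteq> 0" using p by (auto simp: graph_domain_def)
  ultimately show "p \<in> X" by (simp only: X_iff Q_eq_0_iff simp_thms)
qed

text \<open>The charts are shears in the y-direction. Subtracting \<open>graph \<sigma>\<close> from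
  y flattens the sheet through \<open>p\<close> to the plane y = 0; adding it back is the inverse,
  since \<open>graph \<sigma>\<close> does not depend on y.\<close>

lemma smooth_submanifold_X: "smooth_submanifold X"
proof -
  define L where "L = {p :: real^3. axis 2 1 \<bullet> p = 0}"
  have "smooth_submanifold_dim (dim L) X"
    unfolding smooth_submanifold_dim_def
  proof
    fix p assume p: "p \<in> X"
    define \<sigma> where "\<sigma> = sgn (p $ 2)"
    have \<sigma>: "\<bar>\<sigma>\<bar> = 1" "0 < \<sigma> * p $ 2"
      using X_nonzero[OF p] by (auto simp: \<sigma>_def abs_sgn_eq sgn_mult_abs linorder_neq_iff)
    define e :: "real^3" where "e = axis 2 1"
    have e2 [simp]: "e $ 2 = 1" by (simp add: e_def axis_def)
    define U where "U = graph_domain \<sigma> \<inter> {q. 0 < \<sigma> * q $ 2}"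
    \<comment> \<open>This is the preimage of \<open>U\<close> under \<psi>: the inequality says
      that \<psi> \<open>q\<close> has second coordinate of sign \<sigma>.\<close>
    define W where "W = {q \<in> graph_domain \<sigma>. 0 < \<sigma> * (q $ 2 + graph \<sigma> q)}"
    \<comment> \<open>The factor \<open>- 1\<close> lets the product rules for \<open>Ck_on\<close>
      apply directly.\<close>
    define \<phi> where "\<phi> q = q + (- 1 * graph \<sigma> q) *\<^sub>R e" for q
    define \<psi> where "\<psi> q = q + graph \<sigma> q *\<^sub>R e" for q
    note shift = graph_shift[folded e_def] graph_domain_shift[folded e_def]
    have U: "open U" unfolding U_def
      by (intro open_Int open_graph_domain open_Collect_less continuous_intros)
    have cont: "continuous_on (graph_domain \<sigma>) (graph \<sigma>)"
      using Ck_on_graph[of 0] by simp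
    have W: "open W"
    proof -
      have "continuous_on (graph_domain \<sigma>) (\<lambda>q. \<sigma> * (q $ 2 + graph \<sigma> q))"
        by (intro continuous_intros cont)
      from continuous_open_preimage[OF this open_graph_domain open_greaterThan[of 0]]
      show ?thesis by (simp add: W_def vimage_def Int_def)
    qed
    have sub: "U \<subseteq> graph_domain \<sigma>" "W \<subseteq> graph_domain \<sigma>" by (auto simp: U_def W_def)
    have inv: "\<psi> (\<phi> q) = q" "\<phi> (\<psi> q) = q" for q
      by (simp_all only: \<phi>_def \<psi>_def shift) simp_all
    have \<phi>_U: "\<phi> q \<in> W" if "q \<in> U" for q
      using that by (simp only: \<phi>_def U_def W_def shift mem_Collect_eq Int_iff) simp
    have \<psi>_W: "\<psi> q \<in> U" if "q \<in> W" for q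
      using that by (simp only: \<psi>_def U_def W_def shift mem_Collect_eq Int_iff) simp
    have Ck_mono: "Ck_on k f S" if "Ck_on k f T" "S \<subseteq> T"
      for k S T and f :: "real^3 \<Rightarrow> 'z::euclidean_space"
      using that by (induction k arbitrary: f) (auto intro: continuous_on_subset)
    have Ck: "Ck_on k (graph \<sigma>) S" if "S \<subseteq> graph_domain \<sigma>" for k S
      using Ck_mono[OF Ck_on_graph that] .
    have smooth: "smooth_on \<phi> U" "smooth_on \<psi> W"
      unfolding smooth_on_def \<phi>_def \<psi>_def
      by (intro allI Ck_on_add Ck_on_scaleR Ck_on_mult Ck_on_const Ck_on_bounded_linear
          bounded_linear_ident Ck sub U W)+
    then have "continuous_on U \<phi>" "continuous_on W \<psi>"
      unfolding smooth_on_def by (metis Ck_on.simps(1))+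
    then have homeo: "homeomorphism U W \<phi> \<psi>"
      using \<phi>_U \<psi>_W inv by (intro homeomorphismI) auto
    have L: "\<phi> q \<in> L \<longleftrightarrow> q $ 2 = graph \<sigma> q" for q
      by (simp add: L_def \<phi>_def inner_axis')
    have X_L: "q \<in> X \<longleftrightarrow> \<phi> q \<in> L" if "q \<in> U" for q
      using that X_iff_graph[OF \<sigma>(1), of q] by (auto simp: L U_def)
    have img: "\<phi> ` (U \<inter> X) = W \<inter> L"
    proof (intro equalityI subsetI)
      fix r assume r: "r \<in> W \<inter> L"
      then have "\<psi> r \<in> U" "\<psi> r \<in> X" using \<psi>_W[of r] inv(2)[of r] X_L[of "\<psi> r"] by auto
      then show "r \<in> \<phi> ` (U \<inter> X)" using inv(2)[of r] by (metis IntI image_eqI)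
    next
      fix r assume "r \<in> \<phi> ` (U \<inter> X)"
      then obtain q where "r = \<phi> q" "q \<in> U" "q \<in> X" by blast
      then show "r \<in> W \<inter> L" using \<phi>_U[of q] X_L[of q] by blast
    qed
    have "p \<in> U" using p X_iff_graph[OF \<sigma>] \<sigma> by (auto simp: U_def)
    then show "\<exists>U W \<phi> \<psi> L'. open U \<and> p \<in> U \<and> open (W :: (real^3) set) \<and>
        homeomorphism U W \<phi> \<psi> \<and> smooth_on \<phi> U \<and> smooth_on \<psi> W \<and>
        subspace L' \<and> dim L' = dim L \<and> \<phi> ` (U \<inter> X) = W \<inter> L'"
      using U W homeo smooth img subspace_hyperplane[of "axis 2 1 :: real^3", folded L_def]
      by (intro exI[where x = U] exI[where x = W] exI[where x = \<phi>] exI[where x = \<psi>]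
          exI[where x = L]) simp
  qed
  then show ?thesis by (auto simp: smooth_submanifold_def)
qed

section \<open>Tangent planes of the surface\<close>

lemma velocity_orthogonal_grad:
  assumes "\<And>t. \<gamma> t \<in> X" "(\<gamma> has_vector_derivative v) (at 0)"
  shows "grad (\<gamma> 0) \<bullet> v = 0"
proof -
  have "((\<lambda>t. (\<gamma> t $ 2) ^ a - Q (\<gamma> t)) has_derivative (\<lambda>t. grad (\<gamma> 0) \<bullet> (t *\<^sub>R v))) (at 0)"
    using has_derivative_compose[OF assms(2)[unfolded has_vector_derivative_def]
        has_derivative_equation] .
  moreover have "(\<lambda>t. (\<gamma> t $ 2) ^ a - Q (\<gamma> t)) = (\<lambda>_. 0)"
    using assms(1) by (auto simp only: X_iff diff_self)
  ultimately have "(\<lambda>t. grad (\<gamma> 0) \<bullet> (t *\<^sub>R v)) = (\<lambda>_. 0)"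
    by (metis has_derivative_const has_derivative_unique)
  then show ?thesis by (metis scaleR_one)
qed

text \<open>For the converse inclusion the line through \<open>p\<close> in direction
  \<open>v\<close> is moved onto the sheet by changing only y. The resulting velocity differs from
  \<open>v\<close> by a multiple of \<open>e\<close>, and orthogonality to the gradient makes that
  multiple 0.\<close>

lemma tangent_space_X:
  assumes p: "p \<in> X"
  shows "tangent_space X p = {v. grad p \<bullet> v = 0}"
proof (intro equalityI subsetI)
  fix v assume "v \<in> tangent_space X p"
  then show "v \<in> {v. grad p \<bullet> v = 0}"
    using velocity_orthogonal_grad unfolding tangent_space_def by blast
next
  fix v assume "v \<in> {v. grad p \<bullet> v = 0}"
  then have v: "grad p \<bullet> v = 0" by simp
  define \<sigma> where "\<sigma> = sgn (p $ 2)"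
  have \<sigma>: "\<bar>\<sigma>\<bar> = 1" "0 < \<sigma> * p $ 2"
    using X_nonzero[OF p] by (auto simp: \<sigma>_def abs_sgn_eq sgn_mult_abs linorder_neq_iff)
  have p_dom: "p \<in> graph_domain \<sigma>" and p_graph: "p $ 2 = graph \<sigma> p"
    using p X_iff_graph[OF \<sigma>] by auto
  define e :: "real^3" where "e = axis 2 1"
  have e2 [simp]: "e $ 2 = 1" by (simp add: e_def axis_def)
  define \<gamma>0 where "\<gamma>0 t = (p + t *\<^sub>R v) + (graph \<sigma> (p + t *\<^sub>R v) - (p + t *\<^sub>R v) $ 2) *\<^sub>R e"
    for t :: real
  \<comment> \<open>\<open>tangent_space\<close> asks for a curve in the surface at all times; the
    constant value \<open>p\<close> serves where the lift is undefined, away from time 0.\<close>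
  define \<gamma> where "\<gamma> t = (if p + t *\<^sub>R v \<in> graph_domain \<sigma> then \<gamma>0 t else p)" for t
  have in_X: "\<gamma> t \<in> X" for t
  proof (cases "p + t *\<^sub>R v \<in> graph_domain \<sigma>")
    case True
    have "\<gamma>0 t $ 2 = graph \<sigma> (p + t *\<^sub>R v)" by (simp add: \<gamma>0_def)
    moreover have "\<gamma>0 t \<in> graph_domain \<sigma>" "graph \<sigma> (\<gamma>0 t) = graph \<sigma> (p + t *\<^sub>R v)"
      using True by (simp_all only: \<gamma>0_def e_def graph_shift graph_domain_shift)
    ultimately show ?thesis
      using X_iff_graph[OF \<sigma>(1), of "\<gamma>0 t"] graph_power(2)[OF \<sigma>(1) True] True
      by (simp add: \<gamma>_def)
  qed (use p in \<open>simp add: \<gamma>_def\<close>)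
  have \<gamma>_0: "\<gamma> 0 = p" using p_dom p_graph by (simp add: \<gamma>_def \<gamma>0_def)
  have "Ck_on (Suc 0) (graph \<sigma>) (graph_domain \<sigma>)" by (rule Ck_on_graph)
  then have "(graph \<sigma> has_derivative frechet_derivative (graph \<sigma>) (at p)) (at p)"
    using Ck_on_Suc_derivative p_dom by blast
  moreover have line: "((\<lambda>t. p + t *\<^sub>R v) has_derivative (\<lambda>t. t *\<^sub>R v)) (at 0)"
    by (auto intro!: derivative_eq_intros)
  ultimately have "((\<lambda>t. graph \<sigma> (p + t *\<^sub>R v)) has_derivative
      (\<lambda>t. frechet_derivative (graph \<sigma>) (at p) (t *\<^sub>R v))) (at 0)"
    using has_derivative_compose[OF line] by simp
  \<comment> \<open>Only the existence of \<open>h\<close> is needed here; its value comes out of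
    the orthogonality below.\<close>
  then obtain h where h: "((\<lambda>t. graph \<sigma> (p + t *\<^sub>R v)) has_real_derivative h) (at 0)"
    using has_derivative_imp_has_field_derivative real_differentiable_def differentiable_def
    by metis
  have "(\<gamma>0 has_vector_derivative v + (h - v $ 2) *\<^sub>R e) (at 0)"
    unfolding \<gamma>0_def has_vector_derivative_def
    by (auto intro!: derivative_eq_intros h[unfolded has_field_derivative_def]
        simp: algebra_simps)
  moreover have "open {t. p + t *\<^sub>R v \<in> graph_domain \<sigma>}"
    using open_vimage[OF open_graph_domain, of "\<lambda>t. p + t *\<^sub>R v"]
    by (simp add: vimage_def continuous_intros)
  ultimately have deriv: "(\<gamma> has_vector_derivative v + (h - v $ 2) *\<^sub>R e) (at 0)"
    by (rule has_vector_derivative_transform_within_open) (auto simp: \<gamma>_def p_dom)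
  then have "grad p \<bullet> (v + (h - v $ 2) *\<^sub>R e) = 0"
    using velocity_orthogonal_grad[of \<gamma>, OF in_X] \<gamma>_0 by simp
  then have "(h - v $ 2) * grad p $ 2 = 0"
    by (simp add: v inner_add_right e_def inner_axis del: grad_nth)
  then have "h = v $ 2" using X_nonzero[OF p] a_gt by simp
  then have "(\<gamma> has_vector_derivative v) (at 0)" using deriv by simp
  then show "v \<in> tangent_space X p"
    using in_X \<gamma>_0 unfolding tangent_space_def by blast
qed


section \<open>Whitney regularity\<close>

text \<open>Division of \<open>X_abs\<close> by the \<open>a\<close>-th power of
  \<open>\<bar>x\<bar>\<close>. Both remaining exponents of x are positive, so y / x tends to 0 at
  the origin.\<close>

lemma abs_y_over_x_power:
  assumes "p \<in> X"
  shows "(\<bar>p $ 2\<bar> / \<bar>p $ 1\<bar>) ^ a = \<bar>p $ 3\<bar> ^ b * \<bar>p $ 1\<bar> ^ (c - a) + \<bar>p $ 1\<bar> ^ (d - a)"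
proof -
  have "c = (c - a) + a" "d = (d - a) + a" using a_less c_less by auto
  then have "\<bar>p $ 1\<bar> ^ c = \<bar>p $ 1\<bar> ^ (c - a) * \<bar>p $ 1\<bar> ^ a"
    "\<bar>p $ 1\<bar> ^ d = \<bar>p $ 1\<bar> ^ (d - a) * \<bar>p $ 1\<bar> ^ a"
    by (metis power_add)+
  then show ?thesis
    using X_nonzero(1)[OF assms] by (simp add: power_divide X_abs[OF assms] field_simps)
qed

text \<open>An Euler-type computation: x d/dx + y d/dy multiplies each monomial of the equation by
  its degree in x and y. Substituting y^a = A + B leaves coefficients of size at most d.\<close>

lemma radial_derivative_le:
  assumes "p \<in> X"
  shows "\<bar>p $ 1 * grad p $ 1 + p $ 2 * grad p $ 2\<bar> \<le> d * \<bar>p $ 2\<bar> ^ a"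
proof -
  define A where "A = (p $ 3) ^ b * (p $ 1) ^ c"
  define B where "B = (p $ 1) ^ d"
  have pow: "x * x ^ (n - 1) = x ^ n" if "n > 0" for x :: real and n
    using that by (cases n) auto
  have "p $ 1 * grad p $ 1 + p $ 2 * grad p $ 2 =
      real a * (p $ 2 * (p $ 2) ^ (a - 1)) - c * ((p $ 3) ^ b * (p $ 1 * (p $ 1) ^ (c - 1)))
      - d * (p $ 1 * (p $ 1) ^ (d - 1))"
    by (simp add: algebra_simps)
  also have "\<dots> = real a * (A + B) - c * A - d * B"
    using assms[unfolded X_iff] a_gt a_less c_less by (simp only: pow) (simp add: pow Q_def A_def B_def)
  also have "\<dots> = - ((real c - a) * A + (real d - a) * B)" by (simp add: algebra_simps)
  also have "\<bar>\<dots>\<bar> \<le> (real c - a) * \<bar>A\<bar> + (real d - a) * \<bar>B\<bar>"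
    using a_less c_less abs_triangle_ineq[of "(real c - a) * A" "(real d - a) * B"]
    unfolding abs_minus_cancel by (simp add: abs_mult)
  also have "\<dots> \<le> d * \<bar>A\<bar> + d * \<bar>B\<bar>"
    using c_less by (intro add_mono mult_right_mono) auto
  \<comment> \<open>No cancellation occurs between \<open>A\<close> and \<open>B\<close>, which have
    the same sign; this is \<open>X_abs\<close>.\<close>
  also have "\<dots> = d * \<bar>p $ 2\<bar> ^ a"
    by (simp add: X_abs[OF assms] A_def B_def abs_mult power_abs algebra_simps)
  finally show ?thesis .
qed

text \<open>Up to the factor b/a the ratio is z^(b-1) x^c / y^(a-1) in absolute values. Its
  numerator is the product of (z^b x^c)^((b-1)/b) and (x^d)^(c/(bd)), where both bases are at most
  y^a; the power \<open>b * d\<close> clears the fractional exponents.\<close>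

lemma grad_ratio_power_le:
  assumes "p \<in> X"
  shows "(\<bar>grad p $ 3\<bar> / \<bar>grad p $ 2\<bar>) ^ (b * d) \<le>
    real b ^ (b * d) * \<bar>p $ 2\<bar> ^ (b * d - a * (d - c))"
proof -
  define x y z where "x = \<bar>p $ 1\<bar>" and "y = \<bar>p $ 2\<bar>" and "z = \<bar>p $ 3\<bar>"
  have nn: "x > 0" "y > 0" "z \<ge> 0" using X_nonzero[OF assms] by (auto simp: x_def y_def z_def)
  have eq: "y ^ a = z ^ b * x ^ c + x ^ d"
    using X_abs[OF assms] by (simp add: x_def y_def z_def)
  then have A: "z ^ b * x ^ c \<le> y ^ a" and B: "x ^ d \<le> y ^ a" using nn by auto
  obtain b' where b': "b = Suc b'" using b_pos by (cases b) auto
  obtain a' where a': "a = Suc a'" using a_gt by (cases a) auto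
  obtain e where e: "d = c + e" using c_less less_imp_add_positive by blast
  define m where "m = b * d - a * (d - c)"
  have m: "b * d = a * e + m" using b_exponent by (simp add: m_def e)
  \<comment> \<open>The exponent of y in the numerator bound, split into that of the denominator and
    the surplus \<open>m\<close>.\<close>
  have expo: "a * (b' * d + c) = a' * (b * d) + m"
  proof -
    have "a * (b' * d + c) + a * e = a * (b * d)" by (simp add: b' e algebra_simps)
    also have "\<dots> = a' * (b * d) + b * d" by (simp add: a')
    finally show ?thesis using m by simp
  qed
  have "c * (b * d) = c * (b' * d) + d * c" "b' * (b * d) = b * (b' * d)"
    by (simp_all add: b' algebra_simps)
  then have "(z ^ b' * x ^ c) ^ (b * d) = (z ^ b * x ^ c) ^ (b' * d) * (x ^ d) ^ c"
    by (simp only: power_mult_distrib power_mult[symmetric] power_add mult.assoc)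
  also have "\<dots> \<le> (y ^ a) ^ (b' * d) * (y ^ a) ^ c"
    using A B nn by (intro mult_mono power_mono) auto
  also have "\<dots> = (y ^ a') ^ (b * d) * y ^ m"
    by (simp add: expo flip: power_mult power_add distrib_left)
  finally have le: "(z ^ b' * x ^ c) ^ (b * d) \<le> (y ^ a') ^ (b * d) * y ^ m" .
  have "\<bar>grad p $ 3\<bar> / \<bar>grad p $ 2\<bar> = (b / a) * (z ^ b' * x ^ c / y ^ a')"
    unfolding grad_nth by (simp add: a' b' x_def y_def z_def abs_mult power_abs)
  also have "\<dots> ^ (b * d) = (b / a) ^ (b * d) * ((z ^ b' * x ^ c) ^ (b * d) / (y ^ a') ^ (b * d))"
    by (simp only: power_mult_distrib power_divide)
  also have "\<dots> \<le> real b ^ (b * d) * y ^ m"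
  proof (intro mult_mono power_mono)
    show "b / a \<le> real b" using a_gt by (simp add: divide_simps mult_le_cancel_left1)
    show "(z ^ b' * x ^ c) ^ (b * d) / (y ^ a') ^ (b * d) \<le> y ^ m"
      using le nn by (simp add: divide_le_eq mult.commute)
  qed (use nn in auto)
  finally show ?thesis by (simp add: y_def m_def)
qed

lemma secant_inner_le:
  assumes p: "p \<in> X" and q: "q \<in> z_axis"
  shows "\<bar>grad p \<bullet> sgn (q - p)\<bar> / norm (grad p) \<le>
    d * (\<bar>p $ 2\<bar> / \<bar>p $ 1\<bar>) + \<bar>grad p $ 3\<bar> / \<bar>grad p $ 2\<bar>"
proof -
  define N where "N = norm (q - p)"
  define G where "G = norm (grad p)"
  have N1: "\<bar>p $ 1\<bar> \<le> N" and N3: "\<bar>(q - p) $ 3\<bar> \<le> N"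
    using component_le_norm_cart[of "q - p" 1] component_le_norm_cart[of "q - p" 3] q
    by (auto simp: N_def z_axis_iff)
  have G2: "\<bar>grad p $ 2\<bar> \<le> G" unfolding G_def by (rule component_le_norm_cart)
  have nz: "p $ 1 \<noteq> 0" "p $ 2 \<noteq> 0" using X_nonzero[OF p] by auto
  have pos: "0 < \<bar>p $ 1\<bar>" "0 < N" "0 < \<bar>grad p $ 2\<bar>" "0 < G"
  proof -
    show "0 < \<bar>p $ 1\<bar>" "0 < \<bar>grad p $ 2\<bar>" using nz a_gt by auto
    then show "0 < N" "0 < G" using N1 G2 by linarith+
  qed
  \<comment> \<open>Trades the radial bound for a multiple of \<open>G\<close>, which cancels
    against the norm of the gradient.\<close>
  have "\<bar>p $ 2\<bar> ^ a = \<bar>p $ 2\<bar> * \<bar>p $ 2\<bar> ^ (a - 1)" using a_gt by (cases a) auto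
  also have "\<dots> \<le> \<bar>p $ 2\<bar> * \<bar>grad p $ 2\<bar>"
    using a_gt by (intro mult_left_mono) (auto simp: abs_mult power_abs mult_le_cancel_right1)
  also have "\<dots> \<le> \<bar>p $ 2\<bar> * G" using G2 by (intro mult_left_mono) auto
  finally have ya: "\<bar>p $ 2\<bar> ^ a \<le> \<bar>p $ 2\<bar> * G" .
  \<comment> \<open>The first two coordinates of \<open>q\<close> vanish, so the radial part of the
    secant is minus that of \<open>p\<close>.\<close>
  have "grad p \<bullet> (q - p) = - (p $ 1 * grad p $ 1 + p $ 2 * grad p $ 2) + grad p $ 3 * (q - p) $ 3"
    using q unfolding inner_grad by (simp add: z_axis_iff del: grad_nth)
  then have "\<bar>grad p \<bullet> (q - p)\<bar> \<le>
      \<bar>p $ 1 * grad p $ 1 + p $ 2 * grad p $ 2\<bar> + \<bar>grad p $ 3\<bar> * \<bar>(q - p) $ 3\<bar>"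
    using abs_triangle_ineq[of "- (p $ 1 * grad p $ 1 + p $ 2 * grad p $ 2)"
        "grad p $ 3 * (q - p) $ 3"]
    by (simp only: abs_minus_cancel abs_mult)
  also have "\<dots> \<le> d * (\<bar>p $ 2\<bar> * G) + \<bar>grad p $ 3\<bar> * N"
    by (intro add_mono order_trans[OF radial_derivative_le[OF p]] mult_left_mono ya N3) auto
  finally have main: "\<bar>grad p \<bullet> (q - p)\<bar> \<le> d * (\<bar>p $ 2\<bar> * G) + \<bar>grad p $ 3\<bar> * N" .
  have "\<bar>grad p \<bullet> sgn (q - p)\<bar> / G = \<bar>grad p \<bullet> (q - p)\<bar> / (N * G)"
    using pos by (simp add: sgn_div_norm N_def[symmetric] abs_mult divide_simps)
  also have "\<dots> \<le> (d * (\<bar>p $ 2\<bar> * G) + \<bar>grad p $ 3\<bar> * N) / (N * G)"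
    using main pos by (intro divide_right_mono) auto
  also have "\<dots> = d * (\<bar>p $ 2\<bar> / N) + \<bar>grad p $ 3\<bar> / G"
    using pos by (simp add: field_simps del: grad_nth)
  also have "\<dots> \<le> d * (\<bar>p $ 2\<bar> / \<bar>p $ 1\<bar>) + \<bar>grad p $ 3\<bar> / \<bar>grad p $ 2\<bar>"
    using pos N1 G2 by (intro add_mono mult_left_mono divide_left_mono) auto
  finally show ?thesis by (simp only: G_def)
qed

lemma b_regular_X: "b_regular X z_axis 0"
  unfolding b_regular_def
proof (intro allI impI, elim conjE)
  fix x y :: "nat \<Rightarrow> real^3" and \<alpha> l
  assume x: "\<forall>i. x i \<in> X" and y: "\<forall>i. y i \<in> z_axis" and lim: "x \<longlonglongrightarrow> 0"
    and conv: "subspaces_converge (\<lambda>i. tangent_space X (x i)) \<alpha>"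
    and l: "(\<lambda>i. sgn (y i - x i)) \<longlonglongrightarrow> l"
  have xi: "x i \<in> X" "y i \<in> z_axis" for i using x y by blast+
  have comp: "(\<lambda>i. \<bar>x i $ k\<bar>) \<longlonglongrightarrow> 0" for k
    using tendsto_rabs_zero[OF tendsto_vec_nth[OF lim, of k, simplified]] .
  have "(\<lambda>i. \<bar>x i $ 3\<bar> ^ b * \<bar>x i $ 1\<bar> ^ (c - a) + \<bar>x i $ 1\<bar> ^ (d - a))
      \<longlonglongrightarrow> 0 ^ b * 0 ^ (c - a) + 0 ^ (d - a)"
    by (intro tendsto_intros comp)
  then have "(\<lambda>i. (\<bar>x i $ 2\<bar> / \<bar>x i $ 1\<bar>) ^ a) \<longlonglongrightarrow> 0"
    using a_less c_less by (simp add: abs_y_over_x_power[OF xi(1)] power_0_left)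
  then have yx: "(\<lambda>i. \<bar>x i $ 2\<bar> / \<bar>x i $ 1\<bar>) \<longlonglongrightarrow> 0"
    by (rule power_tendsto_zero_cancel[rotated 2]) (use a_gt in auto)
  let ?m = "b * d - a * (d - c)"
  have "(\<lambda>i. real b ^ (b * d) * \<bar>x i $ 2\<bar> ^ ?m) \<longlonglongrightarrow> real b ^ (b * d) * 0 ^ ?m"
    by (intro tendsto_intros comp)
  \<comment> \<open>Here (iv) enters: \<open>?m\<close> is positive, hence \<open>0 ^ ?m\<close> is
    0.\<close>
  then have "(\<lambda>i. real b ^ (b * d) * \<bar>x i $ 2\<bar> ^ ?m) \<longlonglongrightarrow> 0"
    using b_exponent by (simp add: power_0_left)
  then have "(\<lambda>i. (\<bar>grad (x i) $ 3\<bar> / \<bar>grad (x i) $ 2\<bar>) ^ (b * d)) \<longlonglongrightarrow> 0"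
    by (rule Lim_null_comparison[rotated])
      (use grad_ratio_power_le[OF xi(1)] in \<open>simp del: grad_nth add: power_abs\<close>)
  then have zy: "(\<lambda>i. \<bar>grad (x i) $ 3\<bar> / \<bar>grad (x i) $ 2\<bar>) \<longlonglongrightarrow> 0"
    by (rule power_tendsto_zero_cancel[rotated 2]) (use b_pos c_less in auto)
  have "(\<lambda>i. d * (\<bar>x i $ 2\<bar> / \<bar>x i $ 1\<bar>) + \<bar>grad (x i) $ 3\<bar> / \<bar>grad (x i) $ 2\<bar>) \<longlonglongrightarrow> 0"
    using tendsto_add[OF tendsto_mult[OF tendsto_const yx] zy, of "real d"]
    by (simp del: grad_nth)
  then have small: "(\<lambda>i. (grad (x i) \<bullet> sgn (y i - x i)) / norm (grad (x i))) \<longlonglongrightarrow> 0"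
    by (rule Lim_null_comparison[rotated])
      (use secant_inner_le[OF xi] in \<open>simp del: grad_nth\<close>)
  show "l \<in> \<alpha>"
    using limit_of_hyperplanes[OF _ l small] conv grad_nonzero[OF xi(1)]
    by (simp add: tangent_space_X[OF xi(1)])
qed

section \<open>Failure of Kuo-Verdier regularity\<close>

text \<open>Along this curve the two terms \<open>z\<^sup>b x\<^sup>c\<close> and \<open>x\<^sup>d\<close> are equal.\<close>

definition curve :: "real \<Rightarrow> real^3" where
  "curve s = vector [s ^ (a * b), root a 2 * s ^ (b * d), s ^ (a * (d - c))]"

lemma curve_nth [simp]:
  "curve s $ 1 = s ^ (a * b)" "curve s $ 2 = root a 2 * s ^ (b * d)"
  "curve s $ 3 = s ^ (a * (d - c))"
  by (simp_all add: curve_def)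

text \<open>Both terms of \<open>Q\<close> equal \<open>s ^ (a * b * d)\<close>, which accounts for
  the factor \<open>root a 2\<close> in y.\<close>

lemma curve_in_X:
  assumes "s > 0"
  shows "curve s \<in> X"
proof -
  obtain e where e: "d = c + e" using c_less less_imp_add_positive by blast
  have "Q (curve s) = 2 * s ^ (a * b * d)"
    unfolding Q_def curve_nth by (simp add: e flip: power_mult power_add) (simp add: algebra_simps)
  moreover have "(curve s $ 2) ^ a = 2 * s ^ (a * b * d)"
    using a_gt by (simp add: power_mult_distrib mult_ac flip: power_mult)
  ultimately show ?thesis using assms by (simp only: X_iff) simp
qed

lemma curve_tendsto: "(curve \<longlongrightarrow> 0) (at_right 0)"
proof (rule vec_tendstoI)
  fix i :: 3
  have "((\<lambda>s. curve s $ i) \<longlongrightarrow> curve 0 $ i) (at_right 0)"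
    using exhaust_3[of i] by (elim disjE) (auto intro!: tendsto_intros)
  moreover have "curve 0 $ i = 0"
    using exhaust_3[of i] a_gt b_pos c_less by (elim disjE) (auto simp: power_0_left)
  ultimately show "((\<lambda>s. curve s $ i) \<longlongrightarrow> 0 $ i) (at_right 0)" by simp
qed

lemma zero_in_closure_X: "0 \<in> closure X"
proof (rule Lim_in_closed_set[OF closed_closure _ _ curve_tendsto])
  show "\<forall>\<^sub>F s in at_right 0. curve s \<in> closure X"
    using eventually_at_right_less[of 0]
    by eventually_elim (use curve_in_X closure_subset in blast)
qed simp

lemma incident_X: "incident_submanifolds X z_axis 0"
  unfolding incident_submanifolds_def
  using smooth_submanifold_X smooth_submanifold_subspace[OF subspace_z_axis] zero_in_closure_X
  by (auto simp: z_axis_iff)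

text \<open>The y-component has the lowest order in s, and s is at most 1. The constant collects the
  coefficients of the three components.\<close>

lemma norm_grad_curve_le:
  assumes "0 < s" "s \<le> 1"
  shows "norm (grad (curve s)) \<le> (c + d + a * root a 2 ^ (a - 1) + b) * s ^ (b * d * (a - 1))"
proof -
  obtain e where e: "d = c + e" using c_less less_imp_add_positive by blast
  obtain a' where a': "a = Suc a'" using a_gt by (cases a) auto
  obtain b' where b': "b = Suc b'" using b_pos by (cases b) auto
  obtain c' where c': "c = Suc c'" using a_less by (cases c) auto
  define n where "n = b * d * a'"
  \<comment> \<open>The x-component has order ab(d - 1), which exceeds \<open>n\<close> by bd -
    ab.\<close>
  have n: "n \<le> a * b * (c' + e)"
  proof -
    have "b * d \<ge> a * b" using a_less c_less by (simp add: mult.commute)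
    moreover have "n + b * d = a * b * (c' + e) + a * b"
      by (simp add: n_def a' c' e algebra_simps)
    ultimately show ?thesis by linarith
  qed
  \<comment> \<open>The z-component exceeds \<open>n\<close> in order by bd - a(d - c), positive by
    \<open>b_exponent\<close>.\<close>
  have n': "n \<le> a * e * b' + a * b * c"
  proof -
    have "n + b * d = a * e * b' + a * b * c + a * e"
      by (simp add: n_def a' b' e algebra_simps)
    then show ?thesis using b_exponent e by simp
  qed
  have dec: "s ^ k \<le> s ^ n" if "n \<le> k" for k
    using that assms by (intro power_decreasing) auto
  have "\<bar>grad (curve s) $ 1\<bar> = (c + d) * s ^ (a * b * (c' + e))"
    using assms unfolding grad_nth curve_nth abs_minus_cancel
    by (subst abs_of_nonneg) (auto simp: e c' algebra_simps simp flip: power_mult power_add)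
  then have g1: "\<bar>grad (curve s) $ 1\<bar> \<le> (c + d) * s ^ n"
    using dec[OF n] by (simp add: mult_left_mono)
  have g2: "\<bar>grad (curve s) $ 2\<bar> = a * root a 2 ^ (a - 1) * s ^ n"
    using assms a_gt unfolding grad_nth curve_nth n_def
    by (simp add: a' power_mult_distrib abs_mult power_abs flip: power_mult)
  have "b - 1 = b'" "d - c = e" by (simp_all add: b' e)
  then have "\<bar>grad (curve s) $ 3\<bar> = b * s ^ (a * e * b' + a * b * c)"
    using assms by (simp add: power_add power_mult abs_mult)
  then have g3: "\<bar>grad (curve s) $ 3\<bar> \<le> b * s ^ n"
    using dec[OF n'] by (simp add: mult_left_mono)
  have "norm (grad (curve s)) \<le>
      \<bar>grad (curve s) $ 1\<bar> + \<bar>grad (curve s) $ 2\<bar> + \<bar>grad (curve s) $ 3\<bar>"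
    using norm_le_l1_cart[of "grad (curve s)"] by (simp add: sum_3 del: grad_nth)
  also have "\<dots> \<le> (c + d) * s ^ n + a * root a 2 ^ (a - 1) * s ^ n + b * s ^ n"
    using g1 g2 g3 by linarith
  finally show ?thesis by (simp add: n_def a' algebra_simps)
qed

lemma not_w_regular_X: "\<not> w_regular X z_axis 0"
proof
  assume "w_regular X z_axis 0"
  then obtain C U where C: "C > 0" and U: "open U" "0 \<in> U"
    and bound: "\<And>p q. q \<in> U \<Longrightarrow> q \<in> z_axis \<Longrightarrow> p \<in> U \<Longrightarrow> p \<in> X \<Longrightarrow>
       subspace_delta (tangent_space z_axis q) (tangent_space X p) \<le> C * norm (p - q)"
    unfolding w_regular_def by (metis Int_iff)
  \<comment> \<open>The orthogonal projection of the curve point to the axis; the difference is (x,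
    y, 0), of size comparable to \<open>s ^ (a * b)\<close>.\<close>
  define foot :: "real \<Rightarrow> real^3" where "foot s = (curve s $ 3) *\<^sub>R axis 3 1" for s
  have foot_axis: "foot s \<in> z_axis" for s by (simp add: foot_def z_axis_iff axis_def)
  have "((\<lambda>s. (curve s $ 3) *\<^sub>R (axis 3 1 :: real^3)) \<longlongrightarrow> ((0 :: real^3) $ 3) *\<^sub>R axis 3 1) (at_right 0)"
    by (intro tendsto_intros tendsto_vec_nth curve_tendsto)
  then have foot_lim: "(foot \<longlongrightarrow> 0) (at_right 0)" by (simp add: foot_def[abs_def] del: curve_nth)
  \<comment> \<open>The excess of the order of distance times gradient norm over the order of the
    z-component of the gradient; positive by (ii).\<close>
  define n where "n = a * (d - c) - b * (d - a)"
  define K where "K = c + d + a * root a 2 ^ (a - 1) + b"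
  define K' where "K' = C * K * (1 + root a 2)"
  have root_pos: "root a 2 > 0" using a_gt by simp
  then have K: "K \<ge> 0" by (simp add: K_def)
  \<comment> \<open>The (w) estimate between \<open>curve s\<close> and \<open>foot s\<close>, after
    cancelling the power of s in the z-component. Letting s tend to 0 would give b \<le> 0.\<close>
  have main: "b \<le> K' * s ^ n"
    if s: "0 < s" "s < 1" and cU: "curve s \<in> U" and fU: "foot s \<in> U" for s
  proof -
    have cX: "curve s \<in> X" using s curve_in_X by blast
    let ?T = "tangent_space X (curve s)"
    have g0: "norm (grad (curve s)) > 0" using grad_nonzero[OF cX] by simp
    have "\<bar>grad (curve s) \<bullet> axis 3 1\<bar> / norm (grad (curve s)) \<le> infdist (axis 3 1) ?T"
      using infdist_hyperplane_ge grad_nonzero[OF cX] by (simp add: tangent_space_X[OF cX])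
    also have "\<dots> \<le> subspace_delta (tangent_space z_axis (foot s)) ?T"
      by (intro infdist_le_subspace_delta axis_in_tangent_z_axis foot_axis)
        (auto simp: tangent_space_X[OF cX])
    also have "\<dots> \<le> C * norm (curve s - foot s)"
      by (intro bound fU foot_axis cU cX)
    finally have "\<bar>grad (curve s) $ 3\<bar> \<le> C * norm (curve s - foot s) * norm (grad (curve s))"
      using g0 by (simp add: inner_axis field_simps del: grad_nth)
    also have "\<dots> \<le> C * ((1 + root a 2) * s ^ (a * b)) * (K * s ^ (b * d * (a - 1)))"
    proof (intro mult_mono mult_left_mono)
      have "b * d \<ge> a * b" using a_less c_less by (simp add: mult.commute)
      then have le: "s ^ (b * d) \<le> s ^ (a * b)" using s by (intro power_decreasing) auto
      have "norm (curve s - foot s) \<le> s ^ (a * b) + root a 2 * s ^ (b * d)"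
        using norm_le_l1_cart[of "curve s - foot s"] s root_pos
        by (simp add: sum_3 foot_def axis_def abs_mult)
      also have "\<dots> \<le> s ^ (a * b) + root a 2 * s ^ (a * b)"
        using le root_pos by simp
      finally show "norm (curve s - foot s) \<le> (1 + root a 2) * s ^ (a * b)"
        by (simp add: algebra_simps)
      show "norm (grad (curve s)) \<le> K * s ^ (b * d * (a - 1))"
        using norm_grad_curve_le[of s] s by (simp add: K_def)
    qed (use C s root_pos in auto)
    also have "\<dots> = K' * (s ^ (a * b) * s ^ (b * d * (a - 1)))"
      by (simp add: K'_def)
    \<comment> \<open>Adding b(d - a) to the left exponent, or a(d - c) to the right one without
      \<open>n\<close>, gives abd.\<close>
    also have "s ^ (a * b) * s ^ (b * d * (a - 1)) = s ^ (a * (d - c) * (b - 1) + a * b * c) * s ^ n"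
    proof -
      obtain e where e: "d = c + e" using c_less less_imp_add_positive by blast
      obtain f where f: "d = a + f" using a_less c_less less_imp_add_positive less_trans by blast
      obtain a' where a': "a = Suc a'" using a_gt by (cases a) auto
      obtain b' where b': "b = Suc b'" using b_pos by (cases b) auto
      have "d - c = e" "d - a = f" using e f by simp_all
      then have n: "n + b * f = a * e"
        using not_w_exponent unfolding n_def by simp
      have "a * e * b' + a * b * c + a * e = a * b * d" by (simp add: b' e algebra_simps)
      moreover have "a * b + b * d * a' + b * f = a * b * d"
      proof -
        have "a * b + b * f = b * d" by (simp add: f algebra_simps)
        then show ?thesis by (simp add: a' algebra_simps)
      qed
      ultimately have "a * b + b * d * a' = a * e * b' + a * b * c + n" using n by linarith
      moreover have "d - c = e" "a - 1 = a'" "b - 1 = b'" by (simp_all add: a' b' e)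
      ultimately show ?thesis by (simp only: power_add[symmetric])
    qed
    finally have le: "\<bar>grad (curve s) $ 3\<bar> \<le>
      K' * (s ^ (a * (d - c) * (b - 1) + a * b * c) * s ^ n)" .
    have "\<bar>grad (curve s) $ 3\<bar> = b * s ^ (a * (d - c) * (b - 1) + a * b * c)"
      using s by (simp add: power_add flip: power_mult)
    with le have "b * s ^ (a * (d - c) * (b - 1) + a * b * c) \<le>
      (K' * s ^ n) * s ^ (a * (d - c) * (b - 1) + a * b * c)"
      by (simp only: mult_ac)
    then show ?thesis using s by (simp only: mult_le_cancel_right zero_less_power)
  qed
  have "((\<lambda>s. K' * s ^ n) \<longlongrightarrow> K' * 0 ^ n) (at_right 0)" by (intro tendsto_intros)
  moreover have "n > 0" using not_w_exponent by (simp add: n_def)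
  ultimately have "((\<lambda>s. K' * s ^ n) \<longlongrightarrow> 0) (at_right 0)" by (simp add: power_0_left)
  then have "\<forall>\<^sub>F s in at_right 0. K' * s ^ n < b"
    by (rule order_tendstoD(2)) (use b_pos in simp)
  moreover have "\<forall>\<^sub>F s in at_right 0. curve s \<in> U" "\<forall>\<^sub>F s in at_right 0. foot s \<in> U"
    using curve_tendsto foot_lim U by (auto dest: topological_tendstoD)
  moreover have "\<forall>\<^sub>F s in at_right 0. 0 < s \<and> s < (1::real)"
    by (auto intro!: eventually_at_rightI[of 0 1])
  ultimately have "\<forall>\<^sub>F s::real in at_right 0. False"
    by eventually_elim (use main in force)
  then show False by simp
qed

end

section \<open>The stated conditions and an infinite family\<close>

lemma surface_parametersI:
  fixes a b c d :: nat
  assumes "b > 0" "a > 1 \<and> d > c \<and> even b \<and> [d = c] (mod 2)"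
    and ii: "int a * (int d - int c) > int b * \<bar>int d - int a\<bar>"
    and "a < c"
    and iv: "a < b \<or> a \<ge> b \<and> int d * (int a - int b) < int a * int c"
  shows "surface_parameters a b c d"
proof
  have "d > c" "a < d" using assms by auto
  then have i: "int (d - c) = int d - int c" "int (d - a) = int d - int a" by auto
  have "int (b * (d - a)) < int (a * (d - c))"
    using ii \<open>a < d\<close> by (simp add: i)
  then show "b * (d - a) < a * (d - c)" by (simp only: of_nat_less_iff)
  have "int a * (int d - int c) < int b * int d"
    using iv
  proof
    assume "a < b"
    have "int a * (int d - int c) < int a * int d"
      using assms by (intro mult_strict_left_mono) auto
    also have "\<dots> \<le> int b * int d" using \<open>a < b\<close> by (intro mult_right_mono) auto
    finally show ?thesis .
  \<comment> \<open>In the second alternative the inequality is a rearrangement of d(a - b) <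
    ac.\<close>
  qed (simp add: algebra_simps)
  then have "int (a * (d - c)) < int (b * d)" by (simp add: i)
  then show "a * (d - c) < b * d" by (simp only: of_nat_less_iff)
  show "even (d - c)"
    using assms by (auto simp: cong_def mod2_eq_if split: if_splits)
qed (use assms in auto)

theorem mainTheorem1:
  "(\<forall>a b c d :: nat.
      a > 0 \<and> b > 0 \<and> c > 0 \<and> d > 0 \<and>
      (a > 1 \<and> d > c \<and> even b \<and> [d = c] (mod 2)) \<and>
      int a * (int d - int c) > int b * \<bar>int d - int a\<bar> \<and>
      (a < c \<and> d \<ge> b + c) \<and>
      (a < b \<or> a \<ge> b \<and> int d * (int a - int b) < int a * int c)
      \<longrightarrow> incident_submanifolds (surface a b c d - z_axis) z_axis 0 \<and>
          b_regular (surface a b c d - z_axis) z_axis 0 \<and>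
          \<not> w_regular (surface a b c d - z_axis) z_axis 0) \<and>
   infinite {(a, b, c, d).
      a > 0 \<and> b > 0 \<and> c > 0 \<and> d > 0 \<and>
      incident_submanifolds (surface a b c d - z_axis) z_axis 0 \<and>
      b_regular (surface a b c d - z_axis) z_axis 0 \<and>
      \<not> w_regular (surface a b c d - z_axis) z_axis 0}"
  (is "?all \<and> infinite ?S")
proof
  show ?all
  proof (intro allI impI, elim conjE)
    fix a b c d :: nat
    assume "b > 0" "a > 1" "d > c" "even b" "[d = c] (mod 2)"
      "int b * \<bar>int d - int a\<bar> < int a * (int d - int c)" "a < c"
      "a < b \<or> a \<ge> b \<and> int d * (int a - int b) < int a * int c"
    then interpret surface_parameters a b c d by (intro surface_parametersI) auto
    show "incident_submanifolds X z_axis 0 \<and> b_regular X z_axis 0 \<and> \<not> w_regular X z_axis 0"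
      using incident_X b_regular_X not_w_regular_X by blast
  qed
  \<comment> \<open>For a = 4 and b = 2 the two exponent conditions say 2c - 4 < d < 2c. The choice
    d = 2c - 1 is odd, so c runs through the odd numbers from 5 on, the first above a.\<close>
  let ?f = "\<lambda>n::nat. (4::nat, 2::nat, 2 * n + 5, 4 * n + 9)"
  have "?f n \<in> ?S" for n
  proof -
    interpret surface_parameters 4 2 "2 * n + 5" "4 * n + 9"
      by unfold_locales auto
    show ?thesis using incident_X b_regular_X not_w_regular_X by auto
  qed
  then have "range ?f \<subseteq> ?S" by (rule image_subsetI)
  moreover have "inj ?f" by (auto simp: inj_def)
  ultimately show "infinite ?S"
    using range_inj_infinite infinite_super by blast
qed

end
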